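(* Let $G$ be a graph, let $P=\{V_0=\{o\},V_1,\ldots,V_r\}$ be a stabilized weight-equitable partition of $G$ centered at a vertex $o$, and let $G_{B^*}$ be the weight-quotient graph of $P$. Then for any vertex $v$ in $V_i$, \[ H_m(G;(o,v)) = H(G_{B^*};(V_0,V_i)). \]
   Context: The graph $G$ is finite, connected and undirected, with vertex set $V$ and adjacency matrix $A$; $G(u)$ is the set of neighbours of $u$. For a nonnegative square matrix $M=(m_{ij})$, $T(M)$ is the matrix with $(i,j)$-entry $m_{ij}/\sum_l m_{lj}$, read as the transition probability from $j$ to $i$. Let $\lambda_1$ be the largest eigenvalue of $A$ and $\nu=(\nu_u)_{u\in V}$ its positive unit eigenvector (Perron eigenvector), $D_\nu=\mathrm{diag}(\nu)$. The maximal entropy random walk on $G$ has transition matrix $T(D_\nu A)$, i.e. it moves from $u$ to $v\in G(u)$ with probability $\nu_v/\sum_{x\in G(u)}\nu_x$. $H_m(G;(v,u))$ is the expected number of steps needed by the maximal entropy random walk started at $u$ to reach $v$ for the first time, with $H_m(G;(v,v))=0$. For a partition $P=\{V_0,\ldots,V_r\}$ of $V$ and $u\in V_j$, put $b^*_{ij}(u)=\frac{1}{\nu_u}\sum_{v\in G(u)\cap V_i}\nu_v$. $P$ is weight-equitable if, for all $i,j$, $b^*_{ij}(u)$ takes the same value $b^*_{ij}$ for all $u\in V_j$. Then $B^*=(b^*_{ij})$ is the weight-regular quotient matrix, and the weight-quotient graph $G_{B^*}$ is the weighted directed graph (loops allowed) whose vertices are the (nonempty) blocks of $P$ and whose adjacency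 matrix is $B^*$. $P$ is a stabilized weight-equitable partition centered at $o$ if it is weight-equitable and $V_0=\{o\}$. The simple random walk on $G_{B^*}$ is the Markov chain on the blocks with transition matrix $T(B^* )$; $H(G_{B^*};(V_i,V_j))$ is the expected number of steps to first reach $V_i$ starting from $V_j$, with value $0$ when $i=j$. *)

theory Defs
  imports "HOL-Probability.Probability" "Graph_Theory.Digraph_Component"
begin

text \<open>
  Matrices are functions of a row index and a column index; the finite index set is
  always passed explicitly, and values outside it are irrelevant.
\<close>

definition T_matrix :: "'s set \<Rightarrow> ('s \<Rightarrow> 's \<Rightarrow> real) \<Rightarrow> 's \<Rightarrow> 's \<Rightarrow> real" where
  "T_matrix S M i j = M i j / (\<Sum>l\<in>S. M l j)"

text \<open>
  Law of the Markov chain on \<open>S\<close> started at \<open>u\<close>, where \<open>T i j\<close> is the probability of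
  moving from \<open>j\<close> to \<open>i\<close> (so columns sum to one): the path measure on \<open>S\<^sup>\<nat>\<close> obtained from
  the one-step kernels by the Ionescu-Tulcea construction.
\<close>

definition chain_kernel ::
  "'s set \<Rightarrow> ('s \<Rightarrow> 's \<Rightarrow> real) \<Rightarrow> 's \<Rightarrow> nat \<Rightarrow> (nat \<Rightarrow> 's) \<Rightarrow> 's measure" where
  "chain_kernel S T u n \<omega> =
     (if n = 0 then return (count_space S) u
      else point_measure S (\<lambda>i. ennreal (T i (\<omega> (n - 1)))))"

definition chain_law :: "'s set \<Rightarrow> ('s \<Rightarrow> 's \<Rightarrow> real) \<Rightarrow> 's \<Rightarrow> (nat \<Rightarrow> 's) measure" where
  "chain_law S T u =
     projective_family.lim UNIV
       (Ionescu_Tulcea.CI (chain_kernel S T u) (\<lambda>_. count_space S)) (\<lambda>_. count_space S)"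

definition column_stochastic :: "'s set \<Rightarrow> ('s \<Rightarrow> 's \<Rightarrow> real) \<Rightarrow> bool" where
  "column_stochastic S T \<longleftrightarrow>
     (\<forall>j\<in>S. (\<forall>i\<in>S. 0 \<le> T i j) \<and> (\<Sum>i\<in>S. T i j) = 1)"

lemma Ionescu_Tulcea_chain_kernel:
  fixes S :: "'s set"
  assumes fin: "finite S" and st: "column_stochastic S T" and u: "u \<in> S"
  shows "Ionescu_Tulcea (chain_kernel S T u) (\<lambda>_. count_space S)"
proof -
  have ps: "prob_space (point_measure S (\<lambda>i. ennreal (T i j)))" if "j \<in> S" for j
  proof
    have "(\<Sum>i\<in>S. ennreal (T i j)) = ennreal (\<Sum>i\<in>S. T i j)"
      using st that by (intro sum_ennreal) (auto simp: column_stochastic_def)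
    then show "emeasure (point_measure S (\<lambda>i. ennreal (T i j)))
        (space (point_measure S (\<lambda>i. ennreal (T i j)))) = 1"
      using st that fin
      by (simp add: space_point_measure emeasure_point_measure_finite column_stochastic_def)
  qed
  have sub: "point_measure S (\<lambda>i. ennreal (T i j)) \<in> space (subprob_algebra (count_space S))"
    if "j \<in> S" for j
    using ps[OF that]
    by (auto simp: space_subprob_algebra sets_point_measure intro: prob_space_imp_subprob_space)
  show ?thesis
  proof (rule Ionescu_Tulcea.intro)
    fix n :: nat
    show "chain_kernel S T u n \<in> measurable (Pi\<^sub>M {0..<n} (\<lambda>_. count_space S))
        (subprob_algebra (count_space S))"
    proof (cases n)
      case 0
      then show ?thesis
        using u by (auto simp: chain_kernel_def[abs_def] intro!: measurable_const
            simp: space_subprob_algebra prob_space_return intro!: prob_space_imp_subprob_space)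
    next
      case (Suc m)
      have a: "(\<lambda>j. point_measure S (\<lambda>i. ennreal (T i j)))
          \<in> measurable (count_space S) (subprob_algebra (count_space S))"
        using sub by auto
      have b: "(\<lambda>\<omega>. \<omega> m) \<in> measurable (Pi\<^sub>M {0..<n} (\<lambda>_. count_space S)) (count_space S)"
        using Suc by (intro measurable_component_singleton) auto
      show ?thesis
        using measurable_compose[OF b a] Suc by (simp add: chain_kernel_def[abs_def])
    qed
  next
    fix n :: nat and \<omega> :: "nat \<Rightarrow> 's" assume w: "\<omega> \<in> space (Pi\<^sub>M {0..<n} (\<lambda>_. count_space S))"
    show "prob_space (chain_kernel S T u n \<omega>)"
    proof (cases n)
      case 0
      then show ?thesis using u by (auto simp: chain_kernel_def intro!: prob_space_return)
    next
      case (Suc m)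
      then have "\<omega> m \<in> S" using w by (auto simp: space_PiM PiE_iff)
      then show ?thesis using Suc ps by (simp add: chain_kernel_def)
    qed
  qed
qed

lemma chain_law_cylinder:
  fixes S :: "'s set"
  assumes fin: "finite S" and st: "column_stochastic S T" and u: "u \<in> S"
  shows "prob_space (chain_law S T u)"
    and "space (chain_law S T u) = (UNIV \<rightarrow> S)"
    and "sets (chain_law S T u) = sets (Pi\<^sub>M UNIV (\<lambda>_. count_space S))"
    and "(\<And>k. x k \<in> S) \<Longrightarrow>
      emeasure (chain_law S T u) {\<omega> \<in> UNIV \<rightarrow> S. \<forall>k\<le>n. \<omega> k = x k}
        = (if x 0 = u then ennreal (\<Prod>k<n. T (x (Suc k)) (x k)) else 0)"
proof -
  interpret I: Ionescu_Tulcea "chain_kernel S T u" "\<lambda>_. count_space S"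
    by (rule Ionescu_Tulcea_chain_kernel[OF assms])
  note [simp] = PiE_UNIV_domain
  have law: "chain_law S T u = I.PF.lim" by (simp add: chain_law_def)
  show "sets (chain_law S T u) = sets (Pi\<^sub>M UNIV (\<lambda>_. count_space S))" by (simp add: law)
  show "space (chain_law S T u) = (UNIV \<rightarrow> S)" by (simp add: law space_PiM)
  show "prob_space (chain_law S T u)"
  proof
    interpret E: prob_space "I.CI {}" by (rule I.PF.prob_space_P) auto
    have "space (chain_law S T u) = I.PF.emb UNIV {} {\<lambda>_. undefined}"
      unfolding law prod_emb_def by (auto simp: space_PiM PiE_iff restrict_def fun_eq_iff)
    also have "emeasure I.PF.lim \<dots> = emeasure (I.CI {}) {\<lambda>_. undefined}"
      by (rule I.lim) (auto simp: sets_PiM_empty)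
    also have "{\<lambda>_. undefined} = space (I.CI {})"
      by (simp add: I.CI_def space_PiM)
    finally show "emeasure (chain_law S T u) (space (chain_law S T u)) = 1"
      by (simp add: law E.emeasure_space_1)
  qed
  assume x: "\<And>k. x k \<in> S"
  define B where "B m = PiE {0..<m} (\<lambda>k. {x k})" for m
  have B[measurable]: "B m \<in> sets (Pi\<^sub>M {0..<m} (\<lambda>_. count_space S))" for m
    unfolding B_def using x by (intro sets_PiM_I_finite) auto
  have emb: "{\<omega> \<in> UNIV \<rightarrow> S. \<forall>k\<le>n. \<omega> k = x k}
      = prod_emb UNIV (\<lambda>_. count_space S) {0..<Suc n} (B (Suc n))"
    by (auto simp: B_def prod_emb_def PiE_iff space_PiM less_Suc_eq_le)
  have s: "sets (I.C 0 m (\<lambda>_. undefined)) = sets (Pi\<^sub>M {0..<m} (\<lambda>_. count_space S))" for m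
    by (subst I.sets_C) auto
  have sp: "space (I.C 0 m (\<lambda>_. undefined)) = space (Pi\<^sub>M {0..<m} (\<lambda>_. count_space S))" for m
    by (subst I.space_C) auto
  define q where "q m = (if m = 0 then (if x 0 = u then 1 else 0) else ennreal (T (x m) (x (m - 1))))" for m
  have ker: "emeasure (I.eP m \<omega>) (B (Suc m)) = q m * indicator (B m) \<omega>"
    if w: "\<omega> \<in> space (Pi\<^sub>M {0..<m} (\<lambda>_. count_space S))" for m \<omega>
  proof -
    have "fun_upd \<omega> m y \<in> B (Suc m) \<longleftrightarrow> \<omega> \<in> B m \<and> y = x m" for y
      using w by (auto simp: B_def PiE_iff extensional_def space_PiM less_Suc_eq split: if_splits)
    then have "(fun_upd \<omega> m) -` B (Suc m) \<inter> S = (if \<omega> \<in> B m then {x m} else {})"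
      using x by auto
    moreover have "emeasure (chain_kernel S T u m \<omega>) {x m} = q m" if "\<omega> \<in> B m"
    proof (cases m)
      case 0
      then show ?thesis using x by (auto simp: chain_kernel_def q_def indicator_def)
    next
      case (Suc k)
      then have "\<omega> k = x k" using that by (auto simp: B_def PiE_iff)
      then show ?thesis using Suc x fin
        by (simp add: chain_kernel_def q_def emeasure_point_measure_finite)
    qed
    ultimately show ?thesis
      by (simp add: I.emeasure_eP[OF w B])
  qed
  have C: "emeasure (I.C 0 m (\<lambda>_. undefined)) (B m) = (\<Prod>k<m. q k)" for m
  proof (induction m)
    case 0
    have "{\<lambda>_. undefined} \<in> sets (Pi\<^sub>M ({} :: nat set) (\<lambda>_. count_space S))" by (simp add: sets_PiM_empty)
    then show ?case by (simp add: B_def)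
  next
    case (Suc m)
    have "emeasure (I.C 0 (Suc m) (\<lambda>_. undefined)) (B (Suc m))
        = (\<integral>\<^sup>+\<omega>. emeasure (I.eP m \<omega>) (B (Suc m)) \<partial>I.C 0 m (\<lambda>_. undefined))"
      using I.measurable_eP[of m] sp[of m] 
      by (simp, subst emeasure_bind[where N="Pi\<^sub>M {0..<Suc m} (\<lambda>_. count_space S)"])
        (use u in \<open>auto simp: measurable_cong_sets[OF s refl] sp\<close>)
    also have "\<dots> = (\<integral>\<^sup>+\<omega>. q m * indicator (B m) \<omega> \<partial>I.C 0 m (\<lambda>_. undefined))"
      by (intro nn_integral_cong ker) (simp add: sp)
    also have "\<dots> = q m * emeasure (I.C 0 m (\<lambda>_. undefined)) (B m)"
      by (subst nn_integral_cmult_indicator) (auto simp: s)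
    finally show ?case using Suc by (simp add: mult.commute)
  qed
  have "emeasure (chain_law S T u) {\<omega> \<in> UNIV \<rightarrow> S. \<forall>k\<le>n. \<omega> k = x k}
      = emeasure (I.CI {0..<Suc n}) (B (Suc n))"
    unfolding law emb by (rule I.lim) auto
  also have "\<dots> = emeasure (I.C 0 (Suc n) (\<lambda>_. undefined)) (B (Suc n))"
    using sets.sets_into_space[OF B[of "Suc n"]]
    by (subst I.emeasure_CI[of _ "Suc n"]) (auto simp del: I.C.simps simp: prod_emb_id space_PiM)
  also have "\<dots> = (\<Prod>k<Suc n. q k)" by (rule C)
  also have "\<dots> = q 0 * (\<Prod>k<n. q (Suc k))" by (rule prod.lessThan_Suc_shift)
  also have "(\<Prod>k<n. q (Suc k)) = ennreal (\<Prod>k<n. T (x (Suc k)) (x k))"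
    using st x by (simp add: q_def prod_ennreal column_stochastic_def)
  finally show "emeasure (chain_law S T u) {\<omega> \<in> UNIV \<rightarrow> S. \<forall>k\<le>n. \<omega> k = x k}
        = (if x 0 = u then ennreal (\<Prod>k<n. T (x (Suc k)) (x k)) else 0)"
    by (simp add: q_def)
qed

text \<open>First time the path is in state \<open>v\<close>; infinite if it never is, as the infimum of the
  empty set is \<open>\<infinity>\<close>.\<close>

definition hitting_time :: "'s \<Rightarrow> (nat \<Rightarrow> 's) \<Rightarrow> ennreal" where
  "hitting_time v \<omega> = (INF n\<in>{n. \<omega> n = v}. of_nat n)"

text \<open>Arguments are (target, start). The convention for equal arguments agrees with the
  integral whenever \<open>T\<close> is column-stochastic; it also covers the one-vertex graph, where
  the walk cannot move.\<close>

definition expected_hitting_time ::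
  "'s set \<Rightarrow> ('s \<Rightarrow> 's \<Rightarrow> real) \<Rightarrow> 's \<times> 's \<Rightarrow> ennreal" where
  "expected_hitting_time S T = (\<lambda>(v, u).
     if v = u then 0 else (\<integral>\<^sup>+\<omega>. hitting_time v \<omega> \<partial>chain_law S T u))"

definition adjacency :: "('a, 'b) pre_digraph \<Rightarrow> 'a \<Rightarrow> 'a \<Rightarrow> real" where
  "adjacency G u v = (if u \<rightarrow>\<^bsub>G\<^esub> v then 1 else 0)"

definition neighbours :: "('a, 'b) pre_digraph \<Rightarrow> 'a \<Rightarrow> 'a set" where
  "neighbours G u = {v \<in> verts G. u \<rightarrow>\<^bsub>G\<^esub> v}"

definition is_eigenpair :: "'s set \<Rightarrow> ('s \<Rightarrow> 's \<Rightarrow> real) \<Rightarrow> real \<Rightarrow> ('s \<Rightarrow> real) \<Rightarrow> bool" where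
  "is_eigenpair S M k x \<longleftrightarrow>
     (\<exists>i\<in>S. x i \<noteq> 0) \<and> (\<forall>i\<in>S. (\<Sum>j\<in>S. M i j * x j) = k * x i)"

text \<open>Real eigenvalues only, which for the symmetric matrices used below are all of them.\<close>

definition largest_eigenvalue :: "'s set \<Rightarrow> ('s \<Rightarrow> 's \<Rightarrow> real) \<Rightarrow> real" where
  "largest_eigenvalue S M = Max {k. \<exists>x. is_eigenpair S M k x}"

definition perron_eigenvector :: "('a, 'b) pre_digraph \<Rightarrow> ('a \<Rightarrow> real) \<Rightarrow> bool" where
  "perron_eigenvector G \<nu> \<longleftrightarrow>
     is_eigenpair (verts G) (adjacency G) (largest_eigenvalue (verts G) (adjacency G)) \<nu> \<and>
     (\<forall>u\<in>verts G. 0 < \<nu> u) \<and> L2_set \<nu> (verts G) = 1"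

text \<open>The matrix inside \<open>T_matrix\<close> is \<open>D\<^sub>\<nu> A\<close>.\<close>

definition merw_matrix :: "('a, 'b) pre_digraph \<Rightarrow> ('a \<Rightarrow> real) \<Rightarrow> 'a \<Rightarrow> 'a \<Rightarrow> real" where
  "merw_matrix G \<nu> = T_matrix (verts G) (\<lambda>v u. \<nu> v * adjacency G v u)"

definition H_m :: "('a, 'b) pre_digraph \<Rightarrow> ('a \<Rightarrow> real) \<Rightarrow> 'a \<times> 'a \<Rightarrow> ennreal" where
  "H_m G \<nu> = expected_hitting_time (verts G) (merw_matrix G \<nu>)"

definition bstar :: "('a, 'b) pre_digraph \<Rightarrow> ('a \<Rightarrow> real) \<Rightarrow> 'a set \<Rightarrow> 'a \<Rightarrow> real" where
  "bstar G \<nu> U u = (1 / \<nu> u) * (\<Sum>v\<in>neighbours G u \<inter> U. \<nu> v)"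

definition weight_equitable ::
  "('a, 'b) pre_digraph \<Rightarrow> ('a \<Rightarrow> real) \<Rightarrow> 'a set set \<Rightarrow> bool" where
  "weight_equitable G \<nu> P \<longleftrightarrow> partition_on (verts G) P \<and>
     (\<forall>U\<in>P. \<forall>W\<in>P. \<exists>b. \<forall>u\<in>W. bstar G \<nu> U u = b)"

definition stabilized_weight_equitable ::
  "('a, 'b) pre_digraph \<Rightarrow> ('a \<Rightarrow> real) \<Rightarrow> 'a set set \<Rightarrow> 'a \<Rightarrow> bool" where
  "stabilized_weight_equitable G \<nu> P c \<longleftrightarrow> weight_equitable G \<nu> P \<and> {c} \<in> P"

definition weight_quotient_matrix ::
  "('a, 'b) pre_digraph \<Rightarrow> ('a \<Rightarrow> real) \<Rightarrow> 'a set \<Rightarrow> 'a set \<Rightarrow> real" where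
  "weight_quotient_matrix G \<nu> U W = (THE b. \<forall>u\<in>W. bstar G \<nu> U u = b)"

text \<open>A weighted directed graph, loops allowed: \<open>wadj i j\<close> is the weight of the arc from
  \<open>j\<close> to \<open>i\<close>, the orientation in which \<open>T_matrix\<close> reads matrices.\<close>

record 's weighted_digraph =
  wverts :: "'s set"
  wadj :: "'s \<Rightarrow> 's \<Rightarrow> real"

definition weight_quotient_graph ::
  "('a, 'b) pre_digraph \<Rightarrow> ('a \<Rightarrow> real) \<Rightarrow> 'a set set \<Rightarrow> 'a set weighted_digraph" where
  "weight_quotient_graph G \<nu> P = \<lparr> wverts = P, wadj = weight_quotient_matrix G \<nu> \<rparr>"

definition H_srw :: "'s weighted_digraph \<Rightarrow> 's \<times> 's \<Rightarrow> ennreal" where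
  "H_srw Q = expected_hitting_time (wverts Q) (T_matrix (wverts Q) (wadj Q))"

end

theory Submission
  imports Defs
begin

text \<open>
  Conditioned on being at a vertex \<open>u\<close> of a block \<open>W\<close>, the maximal entropy random walk moves into
  a block \<open>U\<close> with probability
  \<open>(\<Sum>v\<in>neighbours G u \<inter> U. \<nu> v) / (\<Sum>v\<in>neighbours G u. \<nu> v)\<close>.
  Dividing numerator and denominator by \<open>\<nu> u\<close> turns this into \<open>b\<^sup>*\<^sub>U\<^sub>W / (\<Sum>L. b\<^sup>*\<^sub>L\<^sub>W)\<close>, which does not
  depend on the choice of \<open>u\<close> in \<open>W\<close> and is the transition probability of the simple random walk on
  the weight-quotient graph (lemma \<open>merw_lumpable\<close>). So the block process of the maximal entropy
  random walk is that simple random walk: the partition is a lumping of the chain.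

  For lumpable chains hitting times agree because the target \<open>{c}\<close> is itself a block, so
  avoiding \<open>c\<close> means the same as avoiding the block \<open>{c}\<close>. To make this precise without
  constructing a coupling of the two path measures, the expected hitting time is written as the
  sum over \<open>n\<close> of the probability of having avoided the target up to time \<open>n\<close> (lemma
  \<open>expected_hitting_time_eq_suminf\<close>). These avoidance probabilities satisfy a one-step recursion
  in \<open>n\<close>, and a lumping carries the recursion on vertices to the one on blocks
  (lemma \<open>stay_prob_lumpable\<close>).
\<close>

section \<open>Expected hitting times of finite Markov chains\<close>

text \<open>The \<open>n\<close>th term of the series is one exactly when the hitting time exceeds \<open>n\<close>.\<close>

lemma hitting_time_eq_suminf:
  "hitting_time t \<omega> = (\<Sum>n. if \<forall>k\<le>n. \<omega> k \<noteq> t then 1 else 0)"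
proof (cases "\<exists>n. \<omega> n = t")
  case True
  define N where "N = (LEAST n. \<omega> n = t)"
  have N: "\<omega> N = t" "\<And>n. \<omega> n = t \<Longrightarrow> N \<le> n"
    using True by (auto simp: N_def intro: LeastI_ex Least_le)
  have "hitting_time t \<omega> = of_nat N"
    unfolding hitting_time_def
    using N by (intro antisym INF_lower INF_greatest) (auto simp: of_nat_le_iff)
  moreover have "(\<forall>k\<le>n. \<omega> k \<noteq> t) \<longleftrightarrow> n < N" for n
    using N by (metis leD leI le_trans)
  then have "(\<Sum>n. if \<forall>k\<le>n. \<omega> k \<noteq> t then 1 else (0::ennreal))
      = (\<Sum>n\<in>{..<N}. if \<forall>k\<le>n. \<omega> k \<noteq> t then 1 else 0)"
    by (intro suminf_finite) auto
  moreover have "\<dots> = of_nat N"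
    using \<open>\<And>n. (\<forall>k\<le>n. \<omega> k \<noteq> t) \<longleftrightarrow> n < N\<close> by simp
  ultimately show ?thesis by simp
next
  case False
  have "(\<Sum>n. 1::ennreal) = \<top>"
  proof (rule ccontr)
    assume "(\<Sum>n. 1::ennreal) \<noteq> \<top>"
    then obtain N :: nat where "(\<Sum>n. 1::ennreal) < of_nat N"
      using ennreal_Ex_less_of_nat less_top by blast
    moreover have "(\<Sum>n\<in>{..<N}. 1::ennreal) \<le> (\<Sum>n. 1)"
      by (intro sum_le_suminf) auto
    ultimately show False by simp
  qed
  with False show ?thesis by (simp add: hitting_time_def)
qed

text \<open>Probability that the chain started at \<open>j\<close> is in \<open>A\<close> at each of the times \<open>1, \<dots>, n\<close>. Time
  \<open>0\<close> is excluded so that the recursion on the first step needs no case distinction on \<open>j\<close>.\<close>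

primrec stay_prob :: "('s \<Rightarrow> 's \<Rightarrow> real) \<Rightarrow> 's set \<Rightarrow> nat \<Rightarrow> 's \<Rightarrow> real" where
  "stay_prob T A 0 j = 1"
| "stay_prob T A (Suc n) j = (\<Sum>i\<in>A. T i j * stay_prob T A n i)"

lemma stay_prob_nonneg:
  assumes "column_stochastic S T" and "A \<subseteq> S" and "j \<in> S"
  shows "0 \<le> stay_prob T A n j"
  using assms(3)
proof (induction n arbitrary: j)
  case (Suc n)
  with assms(1,2) show ?case
    by (auto simp: column_stochastic_def intro!: sum_nonneg mult_nonneg_nonneg)
qed simp

lemma sets_chain_law_all_times:
  assumes "finite S" and "column_stochastic S T" and "u \<in> S"
  shows "{\<omega> \<in> UNIV \<rightarrow> S. \<forall>k. Q k (\<omega> k)} \<in> sets (chain_law S T u)"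
proof -
  let ?N = "Pi\<^sub>M UNIV (\<lambda>_::nat. count_space S)"
  have "{\<omega> \<in> space ?N. Q k (\<omega> k)} \<in> sets ?N" for k
  proof -
    have "(\<lambda>\<omega>. \<omega> k) \<in> measurable ?N (count_space S)"
      by (intro measurable_component_singleton) auto
    then have "(\<lambda>\<omega>. \<omega> k) -` {s \<in> S. Q k s} \<inter> space ?N \<in> sets ?N"
      by (rule measurable_sets) auto
    moreover have "(\<lambda>\<omega>. \<omega> k) -` {s \<in> S. Q k s} \<inter> space ?N = {\<omega> \<in> space ?N. Q k (\<omega> k)}"
      by (auto simp: space_PiM PiE_UNIV_domain)
    ultimately show ?thesis by simp
  qed
  then have "{\<omega> \<in> space ?N. \<forall>k. Q k (\<omega> k)} \<in> sets ?N"
    by (rule sets.sets_Collect_countable_All)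
  then show ?thesis
    using chain_law_cylinder(3)[OF assms] by (simp add: space_PiM PiE_UNIV_domain)
qed

text \<open>The Markov property in the form needed here: after any prescribed history \<open>x 0, \<dots>, x m\<close> the
  probability of staying in \<open>A\<close> for \<open>n\<close> further steps depends on \<open>x m\<close> only. Prescribing a history
  of arbitrary length makes the induction on \<open>n\<close> go through, since splitting on the next state
  lengthens the history by one.\<close>

lemma emeasure_chain_law_history_then_stay:
  assumes "finite S" and st: "column_stochastic S T" and "u \<in> S" and A: "A \<subseteq> S"
    and "\<And>k. x k \<in> S"
  shows "emeasure (chain_law S T u)
      {\<omega> \<in> UNIV \<rightarrow> S. (\<forall>k\<le>m. \<omega> k = x k) \<and> (\<forall>k\<in>{m<..m + n}. \<omega> k \<in> A)}
    = emeasure (chain_law S T u) {\<omega> \<in> UNIV \<rightarrow> S. \<forall>k\<le>m. \<omega> k = x k} * ennreal (stay_prob T A n (x m))"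
  using assms(5)
proof (induction n arbitrary: m x)
  case 0
  then show ?case by simp
next
  case (Suc n)
  let ?M = "chain_law S T u"
  note law = chain_law_cylinder[OF assms(1-3)]
  have finA: "finite A" using A assms(1) finite_subset by blast
  define y where "y i = x(Suc m := i)" for i
  define F where "F i = {\<omega> \<in> UNIV \<rightarrow> S. (\<forall>k\<le>Suc m. \<omega> k = y i k) \<and>
      (\<forall>k\<in>{Suc m<..Suc m + n}. \<omega> k \<in> A)}" for i
  have y: "y i k \<in> S" if "i \<in> A" for i k
    using that A Suc.prems by (auto simp: y_def)
  have yh: "(\<forall>k\<le>Suc m. \<omega> k = y i k) \<longleftrightarrow> (\<forall>k\<le>m. \<omega> k = x k) \<and> \<omega> (Suc m) = i" for \<omega> i
    by (auto simp: y_def le_Suc_eq)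
  have int: "{m<..m + Suc n} = insert (Suc m) {Suc m<..Suc m + n}" by auto
  have split: "{\<omega> \<in> UNIV \<rightarrow> S. (\<forall>k\<le>m. \<omega> k = x k) \<and> (\<forall>k\<in>{m<..m + Suc n}. \<omega> k \<in> A)} = (\<Union>i\<in>A. F i)"
    unfolding F_def yh int by auto
  have Fsets: "F i \<in> sets ?M" for i
  proof -
    have "F i = {\<omega> \<in> UNIV \<rightarrow> S. \<forall>k. (k \<le> Suc m \<longrightarrow> \<omega> k = y i k) \<and>
        (k \<in> {Suc m<..Suc m + n} \<longrightarrow> \<omega> k \<in> A)}"
      unfolding F_def by blast
    then show ?thesis
      using sets_chain_law_all_times[OF assms(1-3),
          of "\<lambda>k s. (k \<le> Suc m \<longrightarrow> s = y i k) \<and> (k \<in> {Suc m<..Suc m + n} \<longrightarrow> s \<in> A)"]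
      by (simp only:)
  qed
  have disj: "disjoint_family_on F A"
    unfolding disjoint_family_on_def F_def yh by auto
  have cyl: "emeasure ?M {\<omega> \<in> UNIV \<rightarrow> S. \<forall>k\<le>Suc m. \<omega> k = y i k}
      = emeasure ?M {\<omega> \<in> UNIV \<rightarrow> S. \<forall>k\<le>m. \<omega> k = x k} * ennreal (T i (x m))" if "i \<in> A" for i
  proof -
    have "(\<Prod>k<Suc m. T (y i (Suc k)) (y i k)) = (\<Prod>k<m. T (x (Suc k)) (x k)) * T i (x m)"
      by (simp add: y_def)
    moreover have "0 \<le> (\<Prod>k<m. T (x (Suc k)) (x k))" "0 \<le> T i (x m)"
      using st Suc.prems that A by (auto simp: column_stochastic_def intro!: prod_nonneg)
    moreover have "y i 0 = x 0" by (simp add: y_def)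
    ultimately show ?thesis
      using law(4)[of "y i" "Suc m"] law(4)[of x m] y[OF that] Suc.prems
      by (simp add: ennreal_mult del: prod.lessThan_Suc)
  qed
  have nonneg: "0 \<le> T i (x m) * stay_prob T A n i" "0 \<le> T i (x m)" if "i \<in> A" for i
    using that A st Suc.prems stay_prob_nonneg[OF st A]
    by (auto simp: column_stochastic_def intro!: mult_nonneg_nonneg)
  have "emeasure ?M (\<Union>i\<in>A. F i) = (\<Sum>i\<in>A. emeasure ?M (F i))"
    using Fsets finA disj by (intro sum_emeasure[symmetric]) auto
  also have "\<dots> = (\<Sum>i\<in>A. emeasure ?M {\<omega> \<in> UNIV \<rightarrow> S. \<forall>k\<le>m. \<omega> k = x k}
      * ennreal (T i (x m) * stay_prob T A n i))"
  proof (intro sum.cong refl)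
    fix i assume i: "i \<in> A"
    have "y i (Suc m) = i" by (simp add: y_def)
    with Suc.IH[of "y i" "Suc m"] y[OF i]
    have "emeasure ?M (F i) = emeasure ?M {\<omega> \<in> UNIV \<rightarrow> S. \<forall>k\<le>Suc m. \<omega> k = y i k}
        * ennreal (stay_prob T A n i)"
      unfolding F_def by simp
    then show "emeasure ?M (F i) = emeasure ?M {\<omega> \<in> UNIV \<rightarrow> S. \<forall>k\<le>m. \<omega> k = x k}
      * ennreal (T i (x m) * stay_prob T A n i)"
      using cyl[OF i] nonneg[OF i] by (simp add: ennreal_mult' mult.assoc)
  qed
  also have "\<dots> = emeasure ?M {\<omega> \<in> UNIV \<rightarrow> S. \<forall>k\<le>m. \<omega> k = x k}
      * ennreal (stay_prob T A (Suc n) (x m))"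
    using nonneg by (simp add: sum_distrib_left[symmetric] sum_ennreal)
  finally show ?case unfolding split .
qed

lemma emeasure_chain_law_avoid:
  assumes "finite S" and "column_stochastic S T" and "u \<in> S" and "u \<noteq> t"
  shows "emeasure (chain_law S T u) {\<omega> \<in> UNIV \<rightarrow> S. \<forall>k\<le>n. \<omega> k \<noteq> t}
    = ennreal (stay_prob T (S - {t}) n u)"
proof -
  let ?M = "chain_law S T u"
  note law = chain_law_cylinder[OF assms(1-3)]
  interpret prob_space ?M by (rule law(1))
  have start: "emeasure ?M {\<omega> \<in> UNIV \<rightarrow> S. \<forall>k\<le>(0::nat). \<omega> k = u} = 1"
    using law(4)[of "\<lambda>_. u" 0] assms(3) by simp
  have meas: "{\<omega> \<in> UNIV \<rightarrow> S. \<omega> 0 = u} \<in> sets ?M"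
    using sets_chain_law_all_times[OF assms(1-3), of "\<lambda>k s. k = 0 \<longrightarrow> s = u"] by simp
  have AE0: "AE \<omega> in ?M. \<omega> 0 = u"
    using start meas law(2) by (intro AE_I_eq_1) simp_all
  have avoid: "{\<omega> \<in> UNIV \<rightarrow> S. \<forall>k\<le>n. \<omega> k \<noteq> t} \<in> sets ?M"
    by (rule sets_chain_law_all_times[OF assms(1-3), of "\<lambda>k s. k \<le> n \<longrightarrow> s \<noteq> t"])
  have stay: "{\<omega> \<in> UNIV \<rightarrow> S. (\<forall>k\<le>(0::nat). \<omega> k = u) \<and> (\<forall>k\<in>{0<..0 + n}. \<omega> k \<in> S - {t})}
      \<in> sets ?M" (is "?E \<in> _")
  proof -
    have "?E = {\<omega> \<in> UNIV \<rightarrow> S. \<forall>k. (k \<le> 0 \<longrightarrow> \<omega> k = u) \<and> (k \<in> {0<..0 + n} \<longrightarrow> \<omega> k \<in> S - {t})}"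
      by blast
    then show ?thesis
      using sets_chain_law_all_times[OF assms(1-3),
          of "\<lambda>k s. (k \<le> 0 \<longrightarrow> s = u) \<and> (k \<in> {0<..0 + n} \<longrightarrow> s \<in> S - {t})"]
      by (simp only:)
  qed
  have "emeasure ?M {\<omega> \<in> UNIV \<rightarrow> S. \<forall>k\<le>n. \<omega> k \<noteq> t} = emeasure ?M ?E"
  proof (rule emeasure_eq_AE[OF _ avoid stay])
    from AE0 show "AE \<omega> in ?M. \<omega> \<in> {\<omega> \<in> UNIV \<rightarrow> S. \<forall>k\<le>n. \<omega> k \<noteq> t} \<longleftrightarrow> \<omega> \<in> ?E"
    proof eventually_elim
      case (elim \<omega>)
      have "(\<forall>k\<le>n. \<omega> k \<noteq> t) \<longleftrightarrow> (\<forall>k\<in>{0<..n}. \<omega> k \<noteq> t)"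
        using elim assms(4) by (metis greaterThanAtMost_iff le0 neq0_conv)
      with elim show ?case by auto
    qed
  qed
  also have "\<dots> = ennreal (stay_prob T (S - {t}) n u)"
    using emeasure_chain_law_history_then_stay[OF assms(1-3), of "S - {t}" "\<lambda>_. u" 0 n]
      start assms(3) by simp
  finally show ?thesis .
qed

text \<open>The tail-sum formula \<open>E \<tau> = (\<Sum>n. P (\<tau> > n))\<close>.\<close>

lemma expected_hitting_time_eq_suminf:
  assumes "finite S" and "column_stochastic S T" and "u \<in> S" and "u \<noteq> t"
  shows "expected_hitting_time S T (t, u) = (\<Sum>n. ennreal (stay_prob T (S - {t}) n u))"
proof -
  let ?M = "chain_law S T u"
  let ?E = "\<lambda>n. {\<omega> \<in> UNIV \<rightarrow> S. \<forall>k\<le>n. \<omega> k \<noteq> t}"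
  note law = chain_law_cylinder[OF assms(1-3)]
  have meas: "?E n \<in> sets ?M" for n :: nat
    by (rule sets_chain_law_all_times[OF assms(1-3), of "\<lambda>k s. k \<le> n \<longrightarrow> s \<noteq> t"])
  have "expected_hitting_time S T (t, u) = (\<integral>\<^sup>+\<omega>. hitting_time t \<omega> \<partial>?M)"
    using assms(4) by (simp add: expected_hitting_time_def)
  also have "\<dots> = (\<integral>\<^sup>+\<omega>. (\<Sum>n. indicator (?E n) \<omega>) \<partial>?M)"
    using law(2)
    by (intro nn_integral_cong) (simp add: hitting_time_eq_suminf indicator_def of_bool_def)
  also have "\<dots> = (\<Sum>n. emeasure ?M (?E n))"
    by (subst nn_integral_suminf)
      (simp_all only: nn_integral_indicator[OF meas] borel_measurable_indicator[OF meas])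
  finally show ?thesis
    by (simp add: emeasure_chain_law_avoid[OF assms])
qed

section \<open>Lumpable chains\<close>

text \<open>Kemeny and Snell's criterion for the sequence of visited blocks to be a Markov chain with
  transition matrix \<open>T'\<close>, whatever the starting state.\<close>

definition lumpable ::
  "'s set set \<Rightarrow> ('s \<Rightarrow> 's \<Rightarrow> real) \<Rightarrow> ('s set \<Rightarrow> 's set \<Rightarrow> real) \<Rightarrow> bool" where
  "lumpable P T T' \<longleftrightarrow> (\<forall>U\<in>P. \<forall>W\<in>P. \<forall>w\<in>W. (\<Sum>i\<in>U. T i w) = T' U W)"

lemma sum_partition_on:
  assumes "finite S" and "partition_on S P"
  shows "(\<Sum>U\<in>P. \<Sum>i\<in>U. f i) = (\<Sum>i\<in>S. f i :: real)"
proof -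
  have "\<forall>U\<in>P. finite U"
    using assms finite_subset by (metis Union_upper partition_onD1)
  moreover have "\<forall>U\<in>P. \<forall>W\<in>P. U \<noteq> W \<longrightarrow> U \<inter> W = {}"
    using partition_onD2[OF assms(2)] by (auto dest: disjointD)
  ultimately show ?thesis
    using sum.Union_disjoint[of P f] partition_onD1[OF assms(2)] by simp
qed

lemma column_stochastic_lumpable:
  assumes "finite S" and "column_stochastic S T" and P: "partition_on S P"
    and l: "lumpable P T T'"
  shows "column_stochastic P T'"
  unfolding column_stochastic_def
proof (intro ballI conjI)
  fix W assume W: "W \<in> P"
  then obtain w where w: "w \<in> W" using partition_onD3[OF P] by fastforce
  have wS: "w \<in> S" using W w partition_onD1[OF P] by auto
  have eq: "T' U W = (\<Sum>i\<in>U. T i w)" if "U \<in> P" for U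
    using l that W w by (simp add: lumpable_def)
  show "(\<Sum>U\<in>P. T' U W) = 1"
    using sum_partition_on[OF assms(1) P, of "\<lambda>i. T i w"] assms(2) wS
    by (simp add: eq column_stochastic_def)
  fix U assume U: "U \<in> P"
  then have "U \<subseteq> S" using partition_onD1[OF P] by auto
  then show "0 \<le> T' U W"
    using assms(2) wS U by (auto simp: eq column_stochastic_def intro!: sum_nonneg)
qed

text \<open>Grouping the first step by blocks, the induction hypothesis makes the remaining probability
  constant on each block, and lumpability adds up the transition probabilities.\<close>

lemma stay_prob_lumpable:
  assumes "finite (\<Union>Q)" and "disjoint Q" and "{} \<notin> Q" and "Q \<subseteq> P"
    and l: "lumpable P T T'" and "W \<in> P" and "w \<in> W"
  shows "stay_prob T (\<Union>Q) n w = stay_prob T' Q n W"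
  using assms(6,7)
proof (induction n arbitrary: w W)
  case (Suc n)
  have "partition_on (\<Union>Q) Q" using assms(2,3) by (simp add: partition_on_def)
  then have "stay_prob T (\<Union>Q) (Suc n) w = (\<Sum>U\<in>Q. \<Sum>i\<in>U. T i w * stay_prob T (\<Union>Q) n i)"
    using sum_partition_on[OF assms(1)] by simp
  also have "\<dots> = (\<Sum>U\<in>Q. \<Sum>i\<in>U. T i w * stay_prob T' Q n U)"
    using Suc.IH assms(4) by (intro sum.cong refl) (metis subsetD)
  also have "\<dots> = (\<Sum>U\<in>Q. T' U W * stay_prob T' Q n U)"
    using l Suc.prems assms(4)
    by (intro sum.cong refl) (auto simp: lumpable_def sum_distrib_right[symmetric])
  finally show ?case by simp
qed simp

lemma expected_hitting_time_lumpable: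
  assumes fin: "finite S" and st: "column_stochastic S T" and P: "partition_on S P"
    and l: "lumpable P T T'" and c: "{c} \<in> P" and W: "W \<in> P" "v \<in> W" and "v \<noteq> c"
  shows "expected_hitting_time S T (c, v) = expected_hitting_time P T' ({c}, W)"
proof -
  have finP: "finite P" using fin P by (rule finite_elements)
  have vS: "v \<in> S" using W partition_onD1[OF P] by auto
  have Wc: "W \<noteq> {c}" using W(2) assms(8) by auto
  have dj: "disjoint P" by (rule partition_onD2[OF P])
  \<comment> \<open>This is where the target being a whole block matters.\<close>
  have un: "\<Union>(P - {{c}}) = S - {c}"
    using partition_onD1[OF P] disjointD[OF dj _ c] by auto
  have "stay_prob T (\<Union>(P - {{c}})) n v = stay_prob T' (P - {{c}}) n W" for n
  proof (rule stay_prob_lumpable[OF _ _ _ _ l W])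
    show "finite (\<Union>(P - {{c}}))" using fin un by simp
    show "disjoint (P - {{c}})" using dj by (rule pairwise_subset) auto
  qed (use partition_onD3[OF P] in auto)
  then show ?thesis
    using expected_hitting_time_eq_suminf[OF fin st vS assms(8)]
      expected_hitting_time_eq_suminf[OF finP column_stochastic_lumpable[OF fin st P l] W(1) Wc]
    by (simp add: un)
qed

section \<open>The maximal entropy random walk\<close>

lemma (in graph) sum_adjacency_column:
  assumes "U \<subseteq> verts G"
  shows "(\<Sum>i\<in>U. \<nu> i * adjacency G i u) = (\<Sum>i\<in>neighbours G u \<inter> U. \<nu> i)"
proof -
  have "finite U" using assms finite_verts finite_subset by blast
  have "(\<Sum>i\<in>U. \<nu> i * adjacency G i u) = (\<Sum>i\<in>U. if i \<in> neighbours G u then \<nu> i else 0)"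
    using assms
    by (intro sum.cong refl) (auto simp: adjacency_def neighbours_def dest: graph_symmetric)
  also have "\<dots> = (\<Sum>i\<in>neighbours G u \<inter> U. \<nu> i)"
    using \<open>finite U\<close> by (simp add: sum.inter_restrict[symmetric] Int_commute)
  finally show ?thesis .
qed

lemma (in graph) sum_neighbours_pos:
  assumes "connected G" and "u \<in> verts G" and "w \<in> verts G" and "u \<noteq> w"
    and "\<And>x. x \<in> verts G \<Longrightarrow> 0 < \<nu> x"
  shows "0 < (\<Sum>i\<in>neighbours G u. \<nu> i :: real)"
proof -
  have "u \<rightarrow>\<^sup>*\<^bsub>G\<^esub> w"
    using symmetric_connected_imp_strongly_connected[OF sym_arcs assms(1)] assms(2,3)
    by (auto simp: strongly_connected_def)
  then obtain x where "u \<rightarrow>\<^bsub>G\<^esub> x"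
    using assms(4) by (cases rule: converse_reachable_cases) auto
  then have "x \<in> neighbours G u" using adj_in_verts by (simp add: neighbours_def)
  then have "neighbours G u \<noteq> {}" by auto
  moreover have "finite (neighbours G u)" by (simp add: neighbours_def)
  ultimately show ?thesis
    using assms(5) by (intro sum_pos) (auto simp: neighbours_def)
qed

text \<open>The column of \<open>u\<close> in \<open>D\<^sub>\<nu> A\<close> sums to \<open>\<Sum>v\<in>neighbours G u. \<nu> v\<close> because \<open>A\<close> is symmetric.
  This is positive, hence \<open>T_matrix\<close> normalises properly, as soon as \<open>u\<close> has a neighbour; the
  one-vertex graph is the exception.\<close>

lemma (in graph) column_stochastic_merw:
  assumes "\<And>x. x \<in> verts G \<Longrightarrow> 0 < \<nu> x"
    and "\<And>u. u \<in> verts G \<Longrightarrow> 0 < (\<Sum>i\<in>neighbours G u. \<nu> i)"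
  shows "column_stochastic (verts G) (merw_matrix G \<nu>)"
  unfolding column_stochastic_def
proof (intro ballI conjI)
  fix u assume u: "u \<in> verts G"
  have sum: "(\<Sum>l\<in>verts G. \<nu> l * adjacency G l u) = (\<Sum>i\<in>neighbours G u. \<nu> i)"
    using sum_adjacency_column[of "verts G"] by (simp add: neighbours_def Int_absorb2)
  show "(\<Sum>i\<in>verts G. merw_matrix G \<nu> i u) = 1"
    using assms(2)[OF u]
    by (simp add: merw_matrix_def T_matrix_def sum sum_divide_distrib[symmetric])
  fix i assume "i \<in> verts G"
  then show "0 \<le> merw_matrix G \<nu> i u"
    using assms(1)[of i] assms(2)[OF u]
    by (simp add: merw_matrix_def T_matrix_def sum) (simp add: adjacency_def)
qed

lemma weight_quotient_matrix_eq:
  assumes "weight_equitable G \<nu> P" and "U \<in> P" and "W \<in> P" and "u \<in> W"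
  shows "weight_quotient_matrix G \<nu> U W = bstar G \<nu> U u"
proof -
  obtain b where "\<forall>u\<in>W. bstar G \<nu> U u = b"
    using assms(1-3) unfolding weight_equitable_def by blast
  with assms(4) show ?thesis
    unfolding weight_quotient_matrix_def by (intro the_equality) auto
qed

text \<open>The factor \<open>1 / \<nu> u\<close> in \<open>bstar G \<nu> U u\<close> does not depend on \<open>U\<close>, so it cancels when the
  column of the quotient matrix is normalised.\<close>

lemma (in graph) merw_lumpable:
  assumes P: "weight_equitable G \<nu> P" and pos: "\<And>x. x \<in> verts G \<Longrightarrow> 0 < \<nu> x"
  shows "lumpable P (merw_matrix G \<nu>) (T_matrix P (weight_quotient_matrix G \<nu>))"
  unfolding lumpable_def
proof (intro ballI)
  fix U W u assume U: "U \<in> P" and W: "W \<in> P" and u: "u \<in> W"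
  have part: "partition_on (verts G) P" using P by (simp add: weight_equitable_def)
  then have sub: "L \<subseteq> verts G" if "L \<in> P" for L
    using that by (auto dest: partition_onD1)
  have nu: "\<nu> u \<noteq> 0" using pos[of u] sub[OF W] u by auto
  define d where "d L = (\<Sum>i\<in>L. \<nu> i * adjacency G i u)" for L
  have quot: "weight_quotient_matrix G \<nu> L W = d L / \<nu> u" if "L \<in> P" for L
    using weight_quotient_matrix_eq[OF P that W u] sub[OF that]
    by (simp add: bstar_def d_def sum_adjacency_column)
  have "(\<Sum>L\<in>P. d L) = d (verts G)"
    unfolding d_def by (intro sum_partition_on part) simp
  then have "(\<Sum>L\<in>P. weight_quotient_matrix G \<nu> L W) = d (verts G) / \<nu> u"
    by (simp add: quot sum_divide_distrib[symmetric])
  then have "T_matrix P (weight_quotient_matrix G \<nu>) U W = d U / d (verts G)"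
    using nu U by (simp add: T_matrix_def quot)
  also have "\<dots> = (\<Sum>i\<in>U. merw_matrix G \<nu> i u)"
    by (simp add: merw_matrix_def T_matrix_def d_def sum_divide_distrib)
  finally show "(\<Sum>i\<in>U. merw_matrix G \<nu> i u) = T_matrix P (weight_quotient_matrix G \<nu>) U W"
    by simp
qed

theorem theorem3p1:
  fixes G :: "('a, 'b) pre_digraph" and \<nu> :: "'a \<Rightarrow> real"
    and P :: "'a set set" and c v :: 'a and W :: "'a set"
  assumes "graph G" and "Digraph_Component.connected G"
    and "perron_eigenvector G \<nu>"
    and "stabilized_weight_equitable G \<nu> P c"
    and "W \<in> P" and "v \<in> W"
  shows "H_m G \<nu> (c, v) = H_srw (weight_quotient_graph G \<nu> P) ({c}, W)"
proof -
  interpret graph G by fact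
  have pos: "\<And>x. x \<in> verts G \<Longrightarrow> 0 < \<nu> x"
    using assms(3) by (simp add: perron_eigenvector_def)
  have P: "weight_equitable G \<nu> P" and c: "{c} \<in> P"
    using assms(4) by (simp_all add: stabilized_weight_equitable_def)
  have part: "partition_on (verts G) P" using P by (simp add: weight_equitable_def)
  have c': "c \<in> verts G" and v': "v \<in> verts G"
    using c assms(5,6) partition_onD1[OF part] by auto
  show ?thesis
  proof (cases "v = c")
    case True
    then have "W = {c}"
      using disjointD[OF partition_onD2[OF part] assms(5) c] assms(6) by auto
    with True show ?thesis
      by (simp add: H_m_def H_srw_def expected_hitting_time_def)
  next
    case False
    have "0 < (\<Sum>i\<in>neighbours G u. \<nu> i)" if "u \<in> verts G" for u
      using sum_neighbours_pos[OF assms(2) that] pos c' v' False by metis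
    then have "column_stochastic (verts G) (merw_matrix G \<nu>)"
      using pos by (intro column_stochastic_merw)
    from expected_hitting_time_lumpable[OF _ this part merw_lumpable[OF P pos] c assms(5,6) False]
    show ?thesis
      by (simp add: H_m_def H_srw_def weight_quotient_graph_def)
  qed
qed

end
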